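(* Let $\mathbb{K}\in\{\mathbb{R},\mathbb{C}\}$, let $\mathcal{A}$ be a unitary Banach algebra over $\mathbb{K}$, and let $\{\alpha_n\}_{n\in\mathbb{N}}\subset\mathbb{K}$ be such that the radius of convergence of the series $g(\lambda)=\sum_{n=0}^{\infty}\alpha_n\lambda^n$ is $R>0$. Let $g^{[1]}:B_R(\mathbf{0})\to B(\mathcal{A})$ be the Fréchet differential function of the map $g:B_R(\mathbf{0})\to\mathcal{A}$, $g(T)=\sum_{n=0}^\infty\alpha_nT^n$. Then: (1) For all $T\in B_R(\mathbf{0})$ $$g^{[1]}(T)=\sum_{n=1}^{\infty}n\alpha_n\mathcal{L}(T)^{n-1}-\left\{\sum_{p=0}^{\infty}\left\{\sum_{n=p+2}^{\infty}(n-p-1)\alpha_n\mathcal{L}(T)^{n-(2+p)}\right\}\mathcal{R}(T)^p\right\}C(T),$$ where all the series converge absolutely uniformly on $B_r(\mathbf{0})$ for all $0<r<R$. (2) For all $T\in B_R(\mathbf{0})$ $$g^{[1]}(T)=\sum_{n=1}^{\infty}n\alpha_n\mathcal{L}(T)^{n-1}-\sum_{k=2}^{\infty}\left\{\sum_{n=k}^{\infty}\alpha_n\mathcal{L}(T)^{n-k}\right\}C(T^{k-1}),$$ where all the series converge absolutely uniformly on $B_r(\mathbf{0})$ for all $0<r<R$. (3) For all $T\in B_{R/3}(\mathbf{0})$ $$g^{[1]}(T)=\sum_{p=1}^{\infty}\frac{1}{p!}g^{(p)}(\mathcal{R}(T))\,C(T)^{p-1},$$ where the series converges absolutely uniformly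 on $B_r(\mathbf{0})$ for all $0<r<\frac{R}{3}$, and $g^{(p)}$ is the $p$-th derivative of the numerical function $g$.
   Context: A Banach algebra is an associative algebra over $\mathbb{K}$ with a complete norm satisfying $\|AB\|\le\|A\|\|B\|$; it is unitary if it has a unit $\mathbf{1}$, and then $\|\mathbf{1}\|=1$ is assumed. $\mathbb{N}=\{0,1,2,\dots\}$. $B_r(\mathbf{0})=\{T\in\mathcal{A}:\|T\|_{\mathcal{A}}<r\}$. $B(\mathcal{A})$ is the unitary Banach algebra (under composition, with operator norm) of bounded linear operators on $\mathcal{A}$. For $T\in\mathcal{A}$ define $\mathcal{R}(T),\mathcal{L}(T),C(T)\in B(\mathcal{A})$ by $\mathcal{R}(T)(h)=Th$, $\mathcal{L}(T)(h)=hT$, $C(T)=\mathcal{L}(T)-\mathcal{R}(T)$, i.e. $C(T)(h)=hT-Th$. Products and powers of these are compositions in $B(\mathcal{A})$, with zeroth power the identity. The Fréchet differential $f^{[1]}(x_0)$ of $f:U\subseteq F\to G$ ($F,G$ Banach spaces over $\mathbb{K}$, $U$ open) at $x_0$ is the bounded $\mathbb{K}$-linear operator $S:F\to G$ with $\lim_{h\to 0,h\ne0}\|f(x_0+h)-f(x_0)-S(h)\|_G/\|h\|_F=0$. If $f(\lambda)=\sum_{n}\beta_n\lambda^n$ has radius of convergence $R$, then for an element $Q$ of any unitary Banach algebra with $\|Q\|<R$ one sets $f(Q)=\sum_n\beta_nQ^n$. In particular $g^{(p)}(\mathcal{R}(T))=\sum_{n=p}^{\infty}p!\binom{n}{p}\alpha_n\mathcal{R}(T)^{n-p}\in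 B(\mathcal{A})$ for $\|T\|_{\mathcal{A}}<R$. A series $\sum_nP_n$ of maps from a set $S$ to a Banach space $X$ converges absolutely uniformly on $S$ if $\sum_n\sup_{u\in S}\|P_n(u)\|_X<\infty$. Here the series are viewed as series of $B(\mathcal{A})$-valued functions of $T$. *)

theory Defs
  imports "HOL-Analysis.Analysis"
begin

text \<open>
  The scalar field is a type of class \<open>{real_normed_field, banach}\<close>. Since the norm of such a
  field is multiplicative, the theorem of Gelfand and Mazur says that the reals and the
  complex numbers are, up to isometric isomorphism, its only instances, so quantifying over
  \<open>'k\<close> is quantifying over the two choices of the scalar field.

  The sort of \<open>'a\<close> gives completeness, submultiplicativity of the norm and \<open>norm 1 = 1\<close>. The
  scalar multiplication by \<open>'k\<close> is a parameter, because the library has no class of complex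
  Banach algebras; it extends the real scalar multiplication of the type.
\<close>

locale unital_banach_algebra = vector_space scl
  for scl :: "'k::{real_normed_field,banach} \<Rightarrow> 'a::{real_normed_algebra_1,banach} \<Rightarrow> 'a" +
  assumes scale_of_real: "scl (of_real r) x = r *\<^sub>R x"
    and norm_scale: "norm (scl c x) = norm c * norm x"
    and scale_mult_left: "scl c x * y = scl c (x * y)"
    and scale_mult_right: "x * scl c y = scl c (x * y)"

lemma unital_banach_algebra_real:
  "unital_banach_algebra (scaleR :: real \<Rightarrow> 'a::{real_normed_algebra_1,banach} \<Rightarrow> 'a)"
  by unfold_locales (auto simp: algebra_simps)

lemma unital_banach_algebra_field:
  "unital_banach_algebra ((*) :: 'k::{real_normed_field,banach} \<Rightarrow> 'k \<Rightarrow> 'k)"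
  by unfold_locales (auto simp: algebra_simps norm_mult scaleR_conv_of_real)


text \<open>
  The operators are elements of the library type of bounded real-linear operators. Its norm is
  the operator norm, and the operators that are linear over \<open>'k\<close> form the closed subset
  \<open>bounded_ops scl\<close>.
\<close>

definition bounded_ops :: "('k \<Rightarrow> 'a \<Rightarrow> 'a) \<Rightarrow> ('a::real_normed_vector \<Rightarrow>\<^sub>L 'a) set" where
  "bounded_ops scl = {S. \<forall>c x. blinfun_apply S (scl c x) = scl c (blinfun_apply S x)}"

definition op_scale ::
  "('k \<Rightarrow> 'a \<Rightarrow> 'a) \<Rightarrow> 'k \<Rightarrow> ('a::real_normed_vector \<Rightarrow>\<^sub>L 'a) \<Rightarrow> ('a \<Rightarrow>\<^sub>L 'a)" where
  "op_scale scl c S = Blinfun (\<lambda>h. scl c (blinfun_apply S h))"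

definition op_power ::
  "('a::real_normed_vector \<Rightarrow>\<^sub>L 'a) \<Rightarrow> nat \<Rightarrow> ('a \<Rightarrow>\<^sub>L 'a)" (infixr \<open>^\<^sub>L\<close> 80) where
  "S ^\<^sub>L n = ((\<lambda>Q. S o\<^sub>L Q) ^^ n) id_blinfun"

abbreviation op_R :: "'a::real_normed_algebra \<Rightarrow> ('a \<Rightarrow>\<^sub>L 'a)" where
  "op_R \<equiv> blinfun_mult_right"

abbreviation op_L :: "'a::real_normed_algebra \<Rightarrow> ('a \<Rightarrow>\<^sub>L 'a)" where
  "op_L \<equiv> blinfun_mult_left"

definition op_C :: "'a::real_normed_algebra \<Rightarrow> ('a \<Rightarrow>\<^sub>L 'a)" where
  "op_C T = op_L T - op_R T"

lemma op_R_apply: "blinfun_apply (op_R T) h = T * h"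
  and op_L_apply: "blinfun_apply (op_L T) h = h * T"
  and op_C_apply: "blinfun_apply (op_C T) h = h * T - T * h"
  by (simp_all add: op_C_def blinfun.diff_left)

lemma (in unital_banach_algebra) op_scale_apply:
  "blinfun_apply (op_scale scl c S) h = scl c (blinfun_apply S h)"
proof -
  have "bounded_linear (\<lambda>h. scl c (blinfun_apply S h))"
  proof (rule bounded_linear_intro)
    show "scl c (blinfun_apply S (x + y)) =
        scl c (blinfun_apply S x) + scl c (blinfun_apply S y)" for x y
      by (simp add: blinfun.add_right scale_right_distrib)
    show "scl c (blinfun_apply S (r *\<^sub>R x)) = r *\<^sub>R scl c (blinfun_apply S x)" for r x
      unfolding blinfun.scaleR_right by (metis scale_of_real scale_left_commute)
    show "norm (scl c (blinfun_apply S x)) \<le> norm x * (norm c * norm S)" for x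
      using mult_left_mono[OF norm_blinfun[of S x], of "norm c"]
      by (simp add: norm_scale mult_ac)
  qed
  then show ?thesis
    by (simp add: op_scale_def bounded_linear_Blinfun_apply)
qed


text \<open>
  The Frechet differential over \<open>'k\<close>: on top of the library's notion, the bounded operator has
  to be linear over \<open>'k\<close>.
\<close>

definition has_frechet_differential ::
  "('k \<Rightarrow> 'a \<Rightarrow> 'a) \<Rightarrow> ('a \<Rightarrow> 'a) \<Rightarrow> ('a \<Rightarrow>\<^sub>L 'a) \<Rightarrow> 'a::real_normed_vector \<Rightarrow> bool" where
  "has_frechet_differential scl f S x \<longleftrightarrow>
     S \<in> bounded_ops scl \<and> (f has_derivative blinfun_apply S) (at x)"

definition frechet_differential ::
  "('k \<Rightarrow> 'a \<Rightarrow> 'a) \<Rightarrow> ('a \<Rightarrow> 'a) \<Rightarrow> 'a::real_normed_vector \<Rightarrow> ('a \<Rightarrow>\<^sub>L 'a)" where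
  "frechet_differential scl f x = (THE S. has_frechet_differential scl f S x)"

lemma frechet_differential_eqI:
  assumes "has_frechet_differential scl f S x"
  shows "frechet_differential scl f x = S"
  unfolding frechet_differential_def
proof (rule the_equality[where P = "\<lambda>S. has_frechet_differential scl f S x", OF assms])
  fix Q assume "has_frechet_differential scl f Q x"
  with assms have "blinfun_apply Q = blinfun_apply S"
    unfolding has_frechet_differential_def by (blast intro: has_derivative_unique)
  then show "Q = S" by (simp add: blinfun_apply_inject)
qed


text \<open>Series whose index starts at \<open>n0\<close>.\<close>

definition series_from :: "nat \<Rightarrow> (nat \<Rightarrow> 'x::real_normed_vector) \<Rightarrow> 'x" where
  "series_from n0 P = (\<Sum>m. P (n0 + m))"

definition abs_unif_conv_from ::
  "nat \<Rightarrow> (nat \<Rightarrow> 's \<Rightarrow> 'x::real_normed_vector) \<Rightarrow> 's set \<Rightarrow> bool" where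
  "abs_unif_conv_from n0 P S \<longleftrightarrow> (\<Sum>m. SUP u\<in>S. ennreal (norm (P (n0 + m) u))) < \<infinity>"

definition alg_power_series ::
  "('k \<Rightarrow> 'a \<Rightarrow> 'a) \<Rightarrow> (nat \<Rightarrow> 'k) \<Rightarrow> 'a::real_normed_algebra_1 \<Rightarrow> 'a" where
  "alg_power_series scl \<alpha> T = (\<Sum>n. scl (\<alpha> n) (T ^ n))"

text \<open>
  The value at an operator \<open>Q\<close> of the \<open>p\<close>-th derivative of the numerical function with Taylor
  coefficients \<open>\<alpha>\<close>. The lemma after the definition says that the coefficients are indeed
  those of the \<open>p\<close>-th derivative.
\<close>

definition op_deriv_series ::
  "('k \<Rightarrow> 'a \<Rightarrow> 'a) \<Rightarrow> (nat \<Rightarrow> 'k::real_normed_field) \<Rightarrow> nat \<Rightarrow>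
     ('a::real_normed_vector \<Rightarrow>\<^sub>L 'a) \<Rightarrow> ('a \<Rightarrow>\<^sub>L 'a)" where
  "op_deriv_series scl \<alpha> p Q =
     series_from p (\<lambda>n. op_scale scl (fact p * of_nat (n choose p) * \<alpha> n) (Q ^\<^sub>L (n - p)))"

lemma higher_deriv_power_series:
  fixes \<alpha> :: "nat \<Rightarrow> 'k::{real_normed_field,banach}"
  assumes "ereal (norm z) < conv_radius \<alpha>"
  shows "(deriv ^^ p) (\<lambda>x. \<Sum>n. \<alpha> n * x ^ n) z =
         series_from p (\<lambda>n. fact p * of_nat (n choose p) * \<alpha> n * z ^ (n - p))"
proof -
  define c where "c p = (\<lambda>m. fact p * of_nat ((p + m) choose p) * \<alpha> (p + m))" for p
  have diffs_c: "diffs (c p) = c (Suc p)" for p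
  proof
    fix m
    have "Suc m * ((p + Suc m) choose p) = Suc p * (Suc (p + m) choose Suc p)"
      using binomial_absorb_comp[of "p + Suc m" p] binomial_absorption[of p "p + Suc m"]
      by simp
    then have "(of_nat (Suc m) * of_nat ((p + Suc m) choose p) :: 'k) =
        of_nat (Suc p) * of_nat (Suc (p + m) choose Suc p)"
      by (metis of_nat_mult)
    then have "fact p * \<alpha> (Suc (p + m)) * (of_nat (Suc m) * of_nat ((p + Suc m) choose p)) =
        fact p * \<alpha> (Suc (p + m)) * (of_nat (Suc p) * of_nat (Suc (p + m) choose Suc p))"
      by simp
    then show "diffs (c p) m = c (Suc p) m"
      unfolding diffs_def c_def fact_Suc
      by (simp only: add_Suc add_Suc_right mult_ac of_nat_mult)
  qed
  have summ: "summable (\<lambda>n. c p n * z ^ n)" if "ereal (norm z) < conv_radius \<alpha>" for p z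
    using that
  proof (induction p arbitrary: z)
    case 0
    then show ?case by (simp add: c_def summable_in_conv_radius)
  next
    case (Suc p)
    obtain K where K: "norm z < K" "ereal K < conv_radius \<alpha>"
      using ereal_dense2[OF Suc.prems] by auto
    have "summable (\<lambda>n. c p n * w ^ n)" if "norm w < K" for w
      using that K by (intro Suc.IH) (metis ereal_less_eq(3) less_imp_le order.strict_trans1)
    then have "summable (\<lambda>n. diffs (c p) n * z ^ n)"
      using K by (intro termdiff_converges[of z K]) auto
    then show ?case by (simp add: diffs_c)
  qed
  have "(deriv ^^ p) (\<lambda>x. \<Sum>n. \<alpha> n * x ^ n) z = (\<Sum>n. c p n * z ^ n)"
    using assms
  proof (induction p arbitrary: z)
    case 0
    then show ?case by (simp add: c_def)
  next
    case (Suc p)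
    obtain K where K: "norm z < K" "ereal K < conv_radius \<alpha>"
      using ereal_dense2[OF Suc.prems] by auto
    have K': "ereal (norm w) < conv_radius \<alpha>" if "norm w < K" for w :: 'k
      using that K by (metis ereal_less_eq(3) less_imp_le order.strict_trans1)
    have "eventually (\<lambda>w. w \<in> ball 0 K) (nhds z)"
      using K by (intro eventually_nhds_in_open) auto
    then have "eventually (\<lambda>w. (deriv ^^ p) (\<lambda>x. \<Sum>n. \<alpha> n * x ^ n) w =
        (\<Sum>n. c p n * w ^ n)) (nhds z)"
      by eventually_elim (auto intro: Suc.IH K')
    then have "(deriv ^^ Suc p) (\<lambda>x. \<Sum>n. \<alpha> n * x ^ n) z = deriv (\<lambda>w. \<Sum>n. c p n * w ^ n) z"
      by (simp add: deriv_cong_ev)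
    also have "\<dots> = (\<Sum>n. diffs (c p) n * z ^ n)"
      using K by (intro DERIV_imp_deriv termdiffs_strong'[of K]) (auto intro: summ K')
    finally show ?case by (simp add: diffs_c)
  qed
  then show ?thesis by (simp add: c_def series_from_def)
qed

end

theory Submission
  imports Defs
begin

text \<open>
  Left and right multiplication by \<open>T\<close> commute, so the derivative of \<open>T\<^sup>n\<^sup>+\<^sup>1\<close> in direction \<open>h\<close>, which is
  the sum of all \<open>T\<^sup>i h T\<^sup>n\<^sup>-\<^sup>i\<close>, is a polynomial in the two commuting operators \<open>op_R T\<close> and
  \<open>op_L T\<close>: the divided difference of the power function at these two points. On \<open>norm T \<le> r\<close>
  its norm is at most \<open>(n + 1) r\<^sup>n\<close>, so for \<open>r < R\<close> the series of derivatives converges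
  uniformly, and a power series may be differentiated term by term
  (\<open>power_series_has_frechet_differential\<close>).

  Each of the three formulas rewrites the divided difference in terms of the commutator
  \<open>op_C T = op_L T - op_R T\<close>. In the first two, every summand is compared with \<open>h T\<^sup>n\<close>, the
  value that it would have if \<open>h\<close> and \<open>T\<close> commuted, and the errors are collected
  (\<open>weighted_commutator_identity\<close>, \<open>commutator_of_powers_identity\<close>). In the third,
  \<open>op_L T = op_R T + op_C T\<close> is expanded by the binomial theorem
  (\<open>binomial_commutator_identity\<close>). These identities hold for each power separately, and they
  group the terms of the power series by degree. The formulas to be proved sum the same terms
  in another order: with \<open>n\<close> the degree up to a shift, a double family \<open>f p m\<close> is summed first
  over \<open>p + m = n\<close> on one side and along rows on the other. So everything reduces to a majorant
  whose diagonal sums converge (\<open>double_series_rearrangement\<close>), and the same majorant gives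
  the absolutely uniform convergence.

  For the first two formulas the diagonal sums of the majorant are controlled by the second
  formal derivative of the series of \<open>norm (\<alpha> n)\<close> at \<open>r\<close>, which has the same radius of convergence.
  In the third, \<open>norm (op_R T) \<le> r\<close> and \<open>norm (op_C T) \<le> 2 * r\<close>, and the binomial theorem puts
  these together to the first formal derivative at \<open>r + 2 r = 3 r\<close>; this is where the radius
  \<open>R / 3\<close> comes from.
\<close>

section \<open>Rearranging a double series along its antidiagonals\<close>

text \<open>
  Fubini for series: by nonnegativity, convergence of the diagonal sums of the majorant \<open>b\<close> is
  unconditional summability over all pairs, and then the rows may be summed first. The bijection
  \<open>(n, p) \<mapsto> (p, n - p)\<close> translates between diagonals and the full quadrant.
\<close>

lemma double_series_rearrangement:
  fixes f :: "nat \<Rightarrow> nat \<Rightarrow> 'x::banach" and b :: "nat \<Rightarrow> nat \<Rightarrow> real"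
  assumes summable_b: "summable (\<lambda>n. \<Sum>p\<le>n. b p (n - p))"
    and bound: "\<And>p m. norm (f p m) \<le> b p m"
  shows summable_row: "summable (b p)"
    and summable_rows: "summable (\<lambda>p. \<Sum>m. b p m)"
    and diagonal_sums: "(\<lambda>n. \<Sum>p\<le>n. f p (n - p)) sums (\<Sum>p. \<Sum>m. f p m)"
proof -
  have b_nonneg: "b p m \<ge> 0" for p m
    using norm_ge_zero bound by (rule order_trans)
  let ?D = "Sigma UNIV (\<lambda>n::nat. {..n})" and ?h = "\<lambda>(n::nat, p). (p, n - p)"
  have bij: "bij_betw ?h ?D (UNIV \<times> UNIV)"
    by (rule bij_betw_byWitness[where f' = "\<lambda>(p, m). (p + m, p)"]) auto
  have "(\<lambda>n. \<Sum>p\<le>n. b p (n - p)) summable_on UNIV"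
    by (rule summable_nonneg_imp_summable_on[OF summable_b]) (simp add: sum_nonneg b_nonneg)
  then have "(\<lambda>x. case_prod b (?h x)) summable_on ?D"
    by (intro summable_on_SigmaI[where g = "\<lambda>n. \<Sum>p\<le>n. b p (n - p)"])
       (auto simp: b_nonneg has_sum_finite_iff)
  then have b_on: "case_prod b summable_on UNIV \<times> UNIV"
    using summable_on_reindex_bij_betw[OF bij, of "case_prod b"] by simp
  have rows: "(b p has_sum (\<Sum>m. b p m)) UNIV" "summable (b p)" for p
  proof -
    have "b p summable_on UNIV"
      using summable_on_SigmaD1[OF b_on, of p] by simp
    then show "summable (b p)" by (rule summable_on_imp_summable)
    then show "(b p has_sum (\<Sum>m. b p m)) UNIV"
      by (intro norm_summable_imp_has_sum) (auto simp: b_nonneg)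
  qed
  show "summable (b p)" by (rule rows)
  obtain s where "(case_prod b has_sum s) (UNIV \<times> UNIV)"
    using b_on by (auto simp: summable_on_def)
  then have "((\<lambda>p. \<Sum>m. b p m) has_sum s) UNIV"
    by (rule has_sum_SigmaD) (simp add: rows)
  then show "summable (\<lambda>p. \<Sum>m. b p m)"
    by (intro sums_summable has_sum_imp_sums)
  have "(\<lambda>x. norm (case_prod f x)) summable_on UNIV \<times> UNIV"
    by (rule summable_on_comparison_test[OF b_on]) (auto simp: bound)
  then obtain S where S: "(case_prod f has_sum S) (UNIV \<times> UNIV)"
    using abs_summable_summable by (auto simp: summable_on_def)
  have "(f p has_sum (\<Sum>m. f p m)) UNIV" for p
  proof (rule norm_summable_imp_has_sum)
    show "summable (\<lambda>m. norm (f p m))"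
      by (rule summable_comparison_test'[OF rows(2)[of p]]) (simp add: bound)
    then show "f p sums (\<Sum>m. f p m)"
      by (rule summable_sums[OF summable_norm_cancel])
  qed
  then have "((\<lambda>p. \<Sum>m. f p m) has_sum S) UNIV"
    by (intro has_sum_SigmaD[OF S]) simp
  then have rows_S: "(\<lambda>p. \<Sum>m. f p m) sums S" by (rule has_sum_imp_sums)
  have "((\<lambda>x. case_prod f (?h x)) has_sum S) ?D"
    using S has_sum_reindex_bij_betw[OF bij, of "case_prod f"] by simp
  then have "((\<lambda>n. \<Sum>p\<le>n. f p (n - p)) has_sum S) UNIV"
    by (rule has_sum_SigmaD) (simp add: has_sum_finite_iff)
  then show "(\<lambda>n. \<Sum>p\<le>n. f p (n - p)) sums (\<Sum>p. \<Sum>m. f p m)"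
    using has_sum_imp_sums sums_unique[OF rows_S] by simp
qed

lemma abs_unif_conv_fromI:
  fixes P :: "nat \<Rightarrow> 's \<Rightarrow> 'x::real_normed_vector"
  assumes summable_c: "summable c"
    and bound: "\<And>m u. u \<in> S \<Longrightarrow> norm (P (n0 + m) u) \<le> c m"
  shows "abs_unif_conv_from n0 P S"
proof (cases "S = {}")
  case True
  \<comment> \<open>Here \<open>c\<close> may be negative; the suprema are \<open>0\<close>.\<close>
  then show ?thesis by (simp add: abs_unif_conv_from_def bot_ennreal)
next
  case False
  then have c_nonneg: "0 \<le> c m" for m
    using norm_ge_zero bound order_trans by blast
  have "(\<Sum>m. SUP u\<in>S. ennreal (norm (P (n0 + m) u))) \<le> (\<Sum>m. ennreal (c m))"
    by (intro suminf_le SUP_least ennreal_leI bound) auto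
  also have "\<dots> = ennreal (\<Sum>m. c m)"
    by (rule suminf_ennreal2[OF c_nonneg summable_c])
  also have "\<dots> < \<infinity>" by simp
  finally show ?thesis by (simp add: abs_unif_conv_from_def)
qed


section \<open>Powers of the multiplication operators\<close>

text \<open>
  Operator powers are evaluated at a vector whenever possible: \<open>op_L\<close> and \<open>op_R\<close> then turn into
  factors on the two sides of \<open>h\<close>, and identities between operators become identities in the
  algebra.
\<close>

lemma op_power_0 [simp]: "S ^\<^sub>L 0 = id_blinfun"
  and op_power_Suc [simp]: "S ^\<^sub>L Suc n = S o\<^sub>L (S ^\<^sub>L n)"
  by (simp_all add: op_power_def)

lemma op_L_power_apply [simp]:
  fixes T :: "'a::real_normed_algebra_1"
  shows "blinfun_apply (op_L T ^\<^sub>L n) h = h * T ^ n"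
  by (induction n) (simp_all add: mult.assoc power_commutes)

lemma op_R_power_apply [simp]:
  fixes T :: "'a::real_normed_algebra_1"
  shows "blinfun_apply (op_R T ^\<^sub>L n) h = T ^ n * h"
  by (induction n) (simp_all add: mult.assoc)

lemma norm_op_L_power_le:
  fixes T :: "'a::real_normed_algebra_1"
  assumes "norm T \<le> r"
  shows "norm (op_L T ^\<^sub>L n) \<le> r ^ n"
proof (rule norm_blinfun_bound)
  have "0 \<le> r" using norm_ge_zero assms by (rule order_trans)
  then show "0 \<le> r ^ n" by simp
  show "norm (blinfun_apply (op_L T ^\<^sub>L n) h) \<le> r ^ n * norm h" for h
  proof -
    have "norm (h * T ^ n) \<le> norm h * norm T ^ n"
      by (meson mult_left_mono norm_ge_zero norm_mult_ineq norm_power_ineq order_trans)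
    also have "\<dots> \<le> norm h * r ^ n"
      by (intro mult_left_mono power_mono assms) auto
    finally show ?thesis by (simp add: mult.commute)
  qed
qed

lemma norm_op_R_power_le:
  fixes T :: "'a::real_normed_algebra_1"
  assumes "norm T \<le> r"
  shows "norm (op_R T ^\<^sub>L n) \<le> r ^ n"
proof (rule norm_blinfun_bound)
  have "0 \<le> r" using norm_ge_zero assms by (rule order_trans)
  then show "0 \<le> r ^ n" by simp
  show "norm (blinfun_apply (op_R T ^\<^sub>L n) h) \<le> r ^ n * norm h" for h
  proof -
    have "norm (T ^ n * h) \<le> norm T ^ n * norm h"
      by (meson mult_right_mono norm_ge_zero norm_mult_ineq norm_power_ineq order_trans)
    also have "\<dots> \<le> r ^ n * norm h"
      by (intro mult_right_mono power_mono assms) auto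
    finally show ?thesis by simp
  qed
qed

lemma norm_op_C_le:
  fixes T :: "'a::real_normed_algebra_1"
  assumes "norm T \<le> r"
  shows "norm (op_C T) \<le> 2 * r"
proof -
  have "op_L T ^\<^sub>L 1 = op_L T" "op_R T ^\<^sub>L 1 = op_R T"
    by (auto intro: blinfun_eqI)
  then have "norm (op_L T) \<le> r" "norm (op_R T) \<le> r"
    using norm_op_L_power_le[OF assms, of 1] norm_op_R_power_le[OF assms, of 1] by simp_all
  then show ?thesis
    using norm_triangle_ineq4[of "op_L T" "op_R T"] by (simp add: op_C_def)
qed

lemma norm_op_power_le:
  fixes S :: "'x::real_normed_vector \<Rightarrow>\<^sub>L 'x"
  assumes "norm S \<le> r"
  shows "norm (S ^\<^sub>L n) \<le> r ^ n"
proof (induction n)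
  case 0
  then show ?case by (auto intro: norm_blinfun_bound)
next
  case (Suc n)
  have "norm (S ^\<^sub>L Suc n) \<le> norm S * norm (S ^\<^sub>L n)"
    by (simp add: norm_blinfun_compose)
  also have "\<dots> \<le> r * r ^ n"
    using Suc assms order_trans[OF norm_ge_zero assms] by (intro mult_mono) auto
  finally show ?case by simp
qed

text \<open>
  The index is one less than the exponent: this is the differential of \<open>T\<^sup>n\<^sup>+\<^sup>1\<close>, which avoids a
  truncated subtraction for the constant term.
\<close>

definition power_differential :: "'a::real_normed_algebra_1 \<Rightarrow> nat \<Rightarrow> ('a \<Rightarrow>\<^sub>L 'a)" where
  "power_differential T n = (\<Sum>i\<le>n. (op_R T ^\<^sub>L i) o\<^sub>L (op_L T ^\<^sub>L (n - i)))"

lemma power_differential_apply: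
  "blinfun_apply (power_differential T n) h = (\<Sum>i\<le>n. T ^ i * h * T ^ (n - i))"
  by (simp add: power_differential_def blinfun.sum_left mult.assoc)

lemma power_differential_Suc:
  "blinfun_apply (power_differential T (Suc n)) h =
     T * blinfun_apply (power_differential T n) h + h * T ^ Suc n"
  by (simp add: power_differential_apply sum.atMost_Suc_shift sum_distrib_left mult.assoc
      del: sum.atMost_Suc)

lemma has_derivative_power_noncommutative:
  fixes T :: "'a::real_normed_algebra_1"
  shows "((\<lambda>x. x ^ Suc n) has_derivative blinfun_apply (power_differential T n)) (at T within S)"
proof (induction n)
  case 0
  have "blinfun_apply (power_differential T 0) = (\<lambda>h. h)"
    by (simp add: power_differential_apply fun_eq_iff)
  then show ?case by simp
next
  case (Suc n)
  have "((\<lambda>x. x * x ^ Suc n) has_derivative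
      (\<lambda>h. T * blinfun_apply (power_differential T n) h + h * T ^ Suc n)) (at T within S)"
    by (rule has_derivative_mult[OF has_derivative_ident Suc])
  then show ?case by (simp add: power_differential_Suc ext)
qed

lemma norm_power_differential_le:
  fixes T :: "'a::real_normed_algebra_1"
  assumes "norm T \<le> r"
  shows "norm (power_differential T n) \<le> real (Suc n) * r ^ n"
proof -
  have r: "0 \<le> r" using norm_ge_zero assms by (rule order_trans)
  have "norm ((op_R T ^\<^sub>L i) o\<^sub>L (op_L T ^\<^sub>L (n - i))) \<le> r ^ n" if "i \<le> n" for i
  proof -
    have "norm ((op_R T ^\<^sub>L i) o\<^sub>L (op_L T ^\<^sub>L (n - i))) \<le> r ^ i * r ^ (n - i)"
      using norm_op_R_power_le[OF assms] norm_op_L_power_le[OF assms] r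
      by (intro order_trans[OF norm_blinfun_compose] mult_mono) auto
    with that show ?thesis by (simp add: power_add [symmetric])
  qed
  then have "norm (power_differential T n) \<le> (\<Sum>i\<le>n. r ^ n)"
    unfolding power_differential_def by (intro sum_norm_le) auto
  then show ?thesis by simp
qed


section \<open>The three finite identities\<close>

text \<open>
  Moving \<open>h\<close> from the left end of \<open>T\<^sup>n\<^sup>+\<^sup>1\<close> to its right end past one factor at a time produces
  one commutator per step.
\<close>

lemma sum_commutator_telescope:
  fixes T h :: "'a::ring_1"
  shows "(\<Sum>p\<le>n. T ^ p * (h * T - T * h) * T ^ (n - p)) = h * T ^ Suc n - T ^ Suc n * h"
proof (induction n)
  case 0
  then show ?case by simp
next
  case (Suc n)
  have "(\<Sum>p\<le>n. T ^ p * (h * T - T * h) * T ^ (Suc n - p)) =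
      (\<Sum>p\<le>n. T ^ p * (h * T - T * h) * T ^ (n - p)) * T"
    unfolding sum_distrib_right
    by (intro sum.cong refl) (simp add: Suc_diff_le mult.assoc power_commutes)
  also have "\<dots> = h * T ^ Suc (Suc n) - T ^ Suc n * h * T"
    unfolding Suc by (simp add: left_diff_distrib mult.assoc power_commutes)
  finally show ?case
    by (simp add: right_diff_distrib mult.assoc power_commutes)
       (simp add: power_commutes mult.assoc [symmetric])
qed

text \<open>
  Each difference \<open>h T\<^sup>n\<^sup>+\<^sup>1 - T\<^sup>i h T\<^sup>n\<^sup>+\<^sup>1\<^sup>-\<^sup>i\<close> telescopes into the commutators at the positions
  \<open>p < i\<close>. The commutator at position \<open>p\<close> is therefore counted once for every \<open>i\<close> in
  \<open>{p<..Suc n}\<close>, which gives its weight. The induction multiplies by \<open>T\<close> on the right and uses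
  the telescoping sum once for the increment of all the weights by one.
\<close>

lemma weighted_commutator_identity:
  fixes T h :: "'a::ring_1"
  shows "(\<Sum>p\<le>n. of_nat (Suc (n - p)) * (T ^ p * (h * T - T * h) * T ^ (n - p))) =
    of_nat (n + 2) * (h * T ^ Suc n) - (\<Sum>i\<le>Suc n. T ^ i * h * T ^ (Suc n - i))"
proof (induction n)
  case 0
  then show ?case by (simp add: algebra_simps mult_2)
next
  case (Suc n)
  let ?c = "\<lambda>n p. T ^ p * (h * T - T * h) * T ^ (n - p)"
  let ?d = "\<lambda>n. \<Sum>i\<le>n. T ^ i * h * T ^ (n - i)"
  have c_Suc: "?c (Suc n) p = ?c n p * T" if "p \<le> n" for p
    using that by (simp add: Suc_diff_le mult.assoc power_commutes)
  have d_Suc: "?d (Suc m) = ?d m * T + T ^ Suc m * h" for m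
  proof -
    have "(\<Sum>i\<le>m. T ^ i * h * T ^ (Suc m - i)) = ?d m * T"
      unfolding sum_distrib_right
      by (intro sum.cong refl) (simp add: Suc_diff_le mult.assoc power_commutes)
    then show ?thesis by simp
  qed
  have "(\<Sum>p\<le>Suc n. of_nat (Suc (Suc n - p)) * ?c (Suc n) p) =
      (\<Sum>p\<le>Suc n. of_nat (Suc n - p) * ?c (Suc n) p) + (\<Sum>p\<le>Suc n. ?c (Suc n) p)"
    by (simp only: of_nat_Suc distrib_right mult_1_left sum.distrib [symmetric] add.commute)
  also have "(\<Sum>p\<le>Suc n. of_nat (Suc n - p) * ?c (Suc n) p) =
      (\<Sum>p\<le>n. of_nat (Suc n - p) * ?c (Suc n) p)" by simp
  also have "\<dots> = (\<Sum>p\<le>n. of_nat (Suc (n - p)) * ?c n p) * T"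
    unfolding sum_distrib_right
  proof (intro sum.cong refl)
    fix p assume "p \<in> {..n}"
    then have "p \<le> n" by simp
    then show "of_nat (Suc n - p) * ?c (Suc n) p = of_nat (Suc (n - p)) * ?c n p * T"
      unfolding c_Suc[OF \<open>p \<le> n\<close>] by (simp only: Suc_diff_le mult.assoc)
  qed
  also have "\<dots> = (of_nat (n + 2) * (h * T ^ Suc n) - ?d (Suc n)) * T"
    by (simp only: Suc)
  also have "(\<Sum>p\<le>Suc n. ?c (Suc n) p) = h * T ^ Suc (Suc n) - T ^ Suc (Suc n) * h"
    by (rule sum_commutator_telescope)
  also have "(of_nat (n + 2) * (h * T ^ Suc n) - ?d (Suc n)) * T +
      (h * T ^ Suc (Suc n) - T ^ Suc (Suc n) * h) =
      of_nat (Suc n + 2) * (h * T ^ Suc (Suc n)) - ?d (Suc (Suc n))"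
  proof -
    have "h * T ^ Suc n * T = h * T ^ Suc (Suc n)"
      by (simp only: mult.assoc power_Suc2 [symmetric])
    moreover have "(of_nat (Suc n + 2) :: 'a) = of_nat (n + 2) + 1" by simp
    ultimately show ?thesis
      unfolding d_Suc[of "Suc n"]
      by (simp only: left_diff_distrib distrib_right mult.assoc mult_1_left) simp
  qed
  finally show ?case .
qed

text \<open>
  The same differences, now without resolving the commutator of \<open>h\<close> with a power of \<open>T\<close>.
\<close>

lemma commutator_of_powers_identity:
  fixes T h :: "'a::ring_1"
  shows "(\<Sum>p\<le>n. (h * T ^ Suc p - T ^ Suc p * h) * T ^ (n - p)) =
    of_nat (n + 2) * (h * T ^ Suc n) - (\<Sum>i\<le>Suc n. T ^ i * h * T ^ (Suc n - i))"
proof -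
  have "(\<Sum>p\<le>n. (h * T ^ Suc p - T ^ Suc p * h) * T ^ (n - p)) =
      (\<Sum>p\<le>n. h * T ^ Suc n - T ^ Suc p * h * T ^ (n - p))"
    by (intro sum.cong refl)
       (simp add: left_diff_distrib mult.assoc power_add [symmetric])
  also have "\<dots> = of_nat (Suc n) * (h * T ^ Suc n) - (\<Sum>p\<le>n. T ^ Suc p * h * T ^ (n - p))"
    by (simp only: sum_subtractf sum_constant card_atMost)
  also have "\<dots> = of_nat (n + 2) * (h * T ^ Suc n) -
      (h * T ^ Suc n + (\<Sum>p\<le>n. T ^ Suc p * h * T ^ (n - p)))"
    by (simp add: algebra_simps)
  finally show ?thesis
    by (simp only: sum.atMost_Suc_shift) simp
qed

text \<open>
  The binomial theorem for \<open>op_L T = op_R T + op_C T\<close>, applied to the vector \<open>c 0\<close>. The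
  sequence \<open>c q\<close> of iterated commutators stands for the powers of \<open>op_C T\<close> at this vector, so
  that the identity lives in an arbitrary ring, and the induction is Pascal's rule.
\<close>

lemma binomial_commutator_expansion:
  fixes T :: "'a::ring_1"
  assumes step: "\<And>q. c (Suc q) = c q * T - T * c q"
  shows "(\<Sum>q\<le>n. of_nat (n choose q) * (T ^ (n - q) * c q)) = c 0 * T ^ n"
proof (induction n)
  case 0
  then show ?case by simp
next
  case (Suc n)
  let ?t = "\<lambda>n q. of_nat (n choose q) * (T ^ (n - q) * c q)"
  have mid: "(\<Sum>q\<le>n. of_nat (n choose Suc q) * (T ^ (n - q) * c (Suc q))) =
      (\<Sum>q\<le>n. of_nat (n choose q) * (T ^ (Suc n - q) * c q)) - T ^ Suc n * c 0"
  proof -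
    have "(\<Sum>q\<le>Suc n. of_nat (n choose q) * (T ^ (Suc n - q) * c q)) =
        T ^ Suc n * c 0 + (\<Sum>q\<le>n. of_nat (n choose Suc q) * (T ^ (n - q) * c (Suc q)))"
      by (simp only: sum.atMost_Suc_shift) simp
    moreover have "(\<Sum>q\<le>Suc n. of_nat (n choose q) * (T ^ (Suc n - q) * c q)) =
        (\<Sum>q\<le>n. of_nat (n choose q) * (T ^ (Suc n - q) * c q))"
      by (simp add: binomial_eq_0)
    ultimately show ?thesis by (simp only: add_diff_cancel_left')
  qed
  have "(\<Sum>q\<le>Suc n. ?t (Suc n) q) =
      T ^ Suc n * c 0 + (\<Sum>q\<le>n. of_nat (Suc n choose Suc q) * (T ^ (n - q) * c (Suc q)))"
    by (simp only: sum.atMost_Suc_shift) simp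
  also have "\<dots> = (\<Sum>q\<le>n. of_nat (n choose q) * (T ^ (n - q) * c (Suc q))) +
      (\<Sum>q\<le>n. of_nat (n choose q) * (T ^ (Suc n - q) * c q))"
    by (simp only: binomial_Suc_Suc of_nat_add distrib_right sum.distrib mid) simp
  also have "\<dots> = (\<Sum>q\<le>n. ?t n q * T)"
    unfolding sum.distrib [symmetric]
    by (intro sum.cong refl)
       (simp add: step Suc_diff_le power_Suc2 algebra_simps del: power_Suc)
  also have "\<dots> = c 0 * T ^ Suc n"
    unfolding sum_distrib_right [symmetric] Suc by (simp add: mult.assoc power_commutes)
  finally show ?case .
qed

text \<open>
  In a field this would be \<open>((R + C)\<^sup>n\<^sup>+\<^sup>1 - R\<^sup>n\<^sup>+\<^sup>1) / C\<close> expanded by the binomial theorem. As \<open>C\<close>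
  cannot be cancelled, both sides are shown to satisfy the recursion
  \<open>x (n + 1) = T * x n + c 0 * T\<^sup>n\<^sup>+\<^sup>1\<close>.
\<close>

lemma binomial_commutator_identity:
  fixes T :: "'a::ring_1"
  assumes step: "\<And>q. c (Suc q) = c q * T - T * c q"
  shows "(\<Sum>q\<le>n. of_nat (Suc n choose Suc q) * (T ^ (n - q) * c q)) =
    (\<Sum>i\<le>n. T ^ i * c 0 * T ^ (n - i))"
proof (induction n)
  case 0
  then show ?case by simp
next
  case (Suc n)
  have "(\<Sum>q\<le>Suc n. of_nat (Suc (Suc n) choose Suc q) * (T ^ (Suc n - q) * c q)) =
      (\<Sum>q\<le>Suc n. of_nat (Suc n choose q) * (T ^ (Suc n - q) * c q)) +
      (\<Sum>q\<le>Suc n. of_nat (Suc n choose Suc q) * (T ^ (Suc n - q) * c q))"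
    by (simp only: binomial_Suc_Suc[of "Suc n"] of_nat_add distrib_right sum.distrib)
  also have "(\<Sum>q\<le>Suc n. of_nat (Suc n choose q) * (T ^ (Suc n - q) * c q)) = c 0 * T ^ Suc n"
    by (rule binomial_commutator_expansion[of c, OF step])
  also have "(\<Sum>q\<le>Suc n. of_nat (Suc n choose Suc q) * (T ^ (Suc n - q) * c q)) =
      (\<Sum>q\<le>n. of_nat (Suc n choose Suc q) * (T ^ (Suc n - q) * c q))"
    by (simp add: binomial_eq_0)
  also have "\<dots> = T * (\<Sum>q\<le>n. of_nat (Suc n choose Suc q) * (T ^ (n - q) * c q))"
    unfolding sum_distrib_left
  proof (intro sum.cong refl)
    fix q assume "q \<in> {..n}"
    then show "of_nat (Suc n choose Suc q) * (T ^ (Suc n - q) * c q) =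
        T * (of_nat (Suc n choose Suc q) * (T ^ (n - q) * c q))"
      by (simp only: Suc_diff_le atMost_iff power_Suc mult.assoc)
         (metis mult.assoc mult_of_nat_commute)
  qed
  also have "\<dots> = T * (\<Sum>i\<le>n. T ^ i * c 0 * T ^ (n - i))" by (simp only: Suc)
  finally show ?case
    by (simp only: sum.atMost_Suc_shift) (simp add: sum_distrib_left mult.assoc)
qed


section \<open>Majorants\<close>

text \<open>
  Formal differentiation keeps the radius of convergence. It is applied to the real series of
  the norms, hence the passage through \<open>of_real\<close>.
\<close>

lemma summable_coefficients_of_derivatives:
  fixes \<alpha> :: "nat \<Rightarrow> 'k::{real_normed_field,banach}"
  assumes r: "0 \<le> r" "ereal r < conv_radius \<alpha>"
  shows summable_diffs: "summable (\<lambda>n. real (Suc n) * norm (\<alpha> (Suc n)) * r ^ n)"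
    and summable_diffs_diffs:
      "summable (\<lambda>n. real (Suc n) * (real (n + 2) * norm (\<alpha> (n + 2))) * r ^ n)"
proof -
  let ?a = "\<lambda>n. norm (\<alpha> n)"
  obtain K where K: "r < K" "ereal K < conv_radius \<alpha>"
    using ereal_dense2[OF r(2)] by auto
  have s0: "summable (\<lambda>n. ?a n * x ^ n)" if "norm x < K" for x
  proof -
    have "summable (\<lambda>n. norm (\<alpha> n * of_real x ^ n))"
    proof (rule abs_summable_in_conv_radius)
      have "ereal (norm (of_real x :: 'k)) \<le> ereal K" using that by simp
      then show "ereal (norm (of_real x :: 'k)) < conv_radius \<alpha>"
        using K(2) by (rule order.strict_trans1)
    qed
    then have "summable (\<lambda>n. norm (?a n * x ^ n))"
      by (simp add: norm_mult norm_power abs_mult power_abs)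
    then show ?thesis by (rule summable_norm_cancel)
  qed
  have s1: "summable (\<lambda>n. diffs ?a n * x ^ n)" if "norm x < K" for x
    using that s0 by (rule termdiff_converges)
  have s2: "summable (\<lambda>n. diffs (diffs ?a) n * r ^ n)"
    using K(1) r(1) by (intro termdiff_converges[of r K] s1) auto
  show "summable (\<lambda>n. real (Suc n) * norm (\<alpha> (Suc n)) * r ^ n)"
    using s1[of r] K(1) r(1) by (simp add: diffs_def)
  show "summable (\<lambda>n. real (Suc n) * (real (n + 2) * norm (\<alpha> (n + 2))) * r ^ n)"
    using s2 by (simp add: diffs_def add.commute)
qed

text \<open>
  The divided difference of the power function between \<open>r\<close> and \<open>3 r\<close>, bounded by the derivative
  at the larger point.
\<close>

lemma sum_binomial_times_power_le:
  fixes r :: real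
  assumes "0 \<le> r"
  shows "(\<Sum>q\<le>n. real (Suc n choose Suc q) * (r ^ (n - q) * (2 * r) ^ q)) \<le>
    real (Suc n) * (3 * r) ^ n"
proof -
  have "(\<Sum>q\<le>n. real (Suc n choose Suc q) * (r ^ (n - q) * (2 * r) ^ q)) \<le>
      (\<Sum>q\<le>n. real (Suc n) * (real (n choose q) * ((2 * r) ^ q * r ^ (n - q))))"
  proof (rule sum_mono)
    fix q assume "q \<in> {..n}"
    have "Suc n choose Suc q \<le> Suc n * (n choose q)"
      by (metis Suc_times_binomial_eq mult_Suc_right le_add1)
    then have "real (Suc n choose Suc q) \<le> real (Suc n) * real (n choose q)"
      by (metis of_nat_le_iff of_nat_mult)
    then have "real (Suc n choose Suc q) * ((2 * r) ^ q * r ^ (n - q)) \<le>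
        real (Suc n) * real (n choose q) * ((2 * r) ^ q * r ^ (n - q))"
      using assms by (intro mult_right_mono) auto
    then show "real (Suc n choose Suc q) * (r ^ (n - q) * (2 * r) ^ q) \<le>
        real (Suc n) * (real (n choose q) * ((2 * r) ^ q * r ^ (n - q)))"
      by (simp only: mult_ac)
  qed
  also have "\<dots> = real (Suc n) * (2 * r + r) ^ n"
    by (simp only: binomial_ring[of "2 * r" r n] sum_distrib_left mult.assoc)
  finally show ?thesis by simp
qed

lemma ereal_less_third_iff:
  "ereal x < R / 3 \<longleftrightarrow> ereal (3 * x) < R"
  by (cases R) (auto simp: field_simps)


section \<open>Scaled operators\<close>

context unital_banach_algebra
begin

lemma scl_of_nat_mult: "scl (of_nat k * c) x = of_nat k * scl c x"
proof -
  have "scl (of_nat k * c) x = real k *\<^sub>R scl c x"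
    using scale_of_real[of "real k" "scl c x"] by simp
  then show ?thesis by (simp add: scaleR_conv_of_real)
qed

lemma bounded_linear_scl: "bounded_linear (scl c)"
proof (rule bounded_linear_intro)
  show "scl c (r *\<^sub>R x) = r *\<^sub>R scl c x" for r x
    by (metis scale_of_real scale_left_commute)
  show "norm (scl c x) \<le> norm x * norm c" for x
    by (simp add: norm_scale mult.commute)
qed (simp add: scale_right_distrib)

lemma norm_op_scale: "norm (op_scale scl c S) \<le> norm c * norm S"
proof (rule norm_blinfun_bound)
  show "norm (blinfun_apply (op_scale scl c S) x) \<le> norm c * norm S * norm x" for x
    using mult_left_mono[OF norm_blinfun[of S x], of "norm c"]
    by (simp add: op_scale_apply norm_scale mult.assoc)
qed simp

lemma bounded_linear_op_scale: "bounded_linear (op_scale scl c)"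
proof (rule bounded_linear_intro)
  show "op_scale scl c (S + Q) = op_scale scl c S + op_scale scl c Q" for S Q
    by (rule blinfun_eqI) (simp add: op_scale_apply blinfun.add_left scale_right_distrib)
  show "op_scale scl c (t *\<^sub>R S) = t *\<^sub>R op_scale scl c S" for t S
    by (rule blinfun_eqI)
       (simp add: op_scale_apply blinfun.scaleR_left
        linear_cmul[OF bounded_linear.linear[OF bounded_linear_scl]])
  show "norm (op_scale scl c S) \<le> norm S * norm c" for S
    using norm_op_scale[of c S] by (simp add: mult.commute)
qed


section \<open>The differential of a power series\<close>

lemma norm_scaled_power_differential_le:
  assumes "norm T \<le> r"
  shows "norm (op_scale scl (\<alpha> (Suc n)) (power_differential T n)) \<le>
    real (Suc n) * norm (\<alpha> (Suc n)) * r ^ n"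
proof -
  have "norm (op_scale scl (\<alpha> (Suc n)) (power_differential T n)) \<le>
      norm (\<alpha> (Suc n)) * (real (Suc n) * r ^ n)"
    by (rule order_trans[OF norm_op_scale mult_left_mono[OF norm_power_differential_le[OF assms]]])
       simp
  then show ?thesis by (simp only: mult_ac)
qed

lemma scaled_power_differential_sums:
  assumes "norm T \<le> r" "0 \<le> r" "ereal r < conv_radius \<alpha>"
  shows "(\<lambda>n. op_scale scl (\<alpha> (Suc n)) (power_differential T n)) sums
    (\<Sum>n. op_scale scl (\<alpha> (Suc n)) (power_differential T n))"
proof (rule summable_sums, rule summable_comparison_test')
  show "summable (\<lambda>n. real (Suc n) * norm (\<alpha> (Suc n)) * r ^ n)"
    using assms(2,3) by (rule summable_diffs)
qed (rule norm_scaled_power_differential_le[OF assms(1)])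

text \<open>
  Term by term differentiation on a ball of radius \<open>r\<close> strictly between \<open>norm T\<close> and the radius
  of convergence: there the Weierstrass test applies to the operator norms of the
  differentials. Linearity over \<open>'k\<close> passes from the terms to the sum.
\<close>

lemma power_series_has_frechet_differential:
  assumes T: "ereal (norm T) < conv_radius \<alpha>"
  shows "has_frechet_differential scl (alg_power_series scl \<alpha>)
    (\<Sum>n. op_scale scl (\<alpha> (Suc n)) (power_differential T n)) T"
proof -
  define D where "D x = (\<Sum>n. op_scale scl (\<alpha> (Suc n)) (power_differential x n))" for x
  obtain r where r: "norm T < r" "ereal r < conv_radius \<alpha>"
    using ereal_dense2[OF T] by auto
  have r0: "0 \<le> r" using r(1) norm_ge_zero[of T] by linarith
  \<comment> \<open>The differential of the \<open>n\<close>-th term, including the constant term at \<open>n = 0\<close>.\<close>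
  define F where "F n x = (case n of 0 \<Rightarrow> 0
    | Suc m \<Rightarrow> op_scale scl (\<alpha> (Suc m)) (power_differential x m))" for n x
  have D_sums: "(\<lambda>n. op_scale scl (\<alpha> (Suc n)) (power_differential x n)) sums D x"
    if "norm x \<le> r" for x
    unfolding D_def using that r0 r(2) by (rule scaled_power_differential_sums)
  have unif: "uniform_limit (ball 0 r) (\<lambda>n x. \<Sum>i<n. F i x) D sequentially"
  proof -
    define M where
      "M n = (case n of 0 \<Rightarrow> 0 | Suc m \<Rightarrow> real (Suc m) * norm (\<alpha> (Suc m)) * r ^ m)" for n
    have "uniform_limit (ball 0 r) (\<lambda>n x. \<Sum>i<n. F i x) (\<lambda>x. \<Sum>i. F i x) sequentially"
    proof (rule Weierstrass_m_test)
      show "norm (F n x) \<le> M n" if "x \<in> ball 0 r" for n x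
        using that norm_scaled_power_differential_le[of x r \<alpha>]
        by (auto simp: F_def M_def split: nat.split)
      show "summable M"
        using summable_diffs[OF r0 r(2)] by (subst summable_Suc_iff [symmetric]) (simp add: M_def)
    qed
    moreover have "(\<Sum>i. F i x) = D x" if "x \<in> ball 0 r" for x
    proof -
      have "(\<lambda>n. F (Suc n) x) sums D x" using D_sums[of x] that by (simp add: F_def)
      moreover have "F 0 x = 0" by (simp add: F_def)
      ultimately have "(\<lambda>n. F n x) sums D x" using sums_Suc_iff[of "\<lambda>n. F n x" "D x"] by simp
      then show ?thesis by (rule sums_unique [symmetric])
    qed
    ultimately show ?thesis
      by (metis (mono_tags, lifting) uniform_limit_cong')
  qed
  have "\<exists>G. \<forall>x\<in>ball 0 r. (\<lambda>n. scl (\<alpha> n) (x ^ n)) sums G x \<and>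
      (G has_derivative blinfun_apply (D x)) (at x within ball 0 r)"
  proof (rule has_derivative_series[where f' = "\<lambda>n x. blinfun_apply (F n x)"])
    show "((\<lambda>x. scl (\<alpha> n) (x ^ n)) has_derivative blinfun_apply (F n x)) (at x within ball 0 r)"
      for n x
    proof (cases n)
      case 0
      then show ?thesis by (simp add: F_def zero_blinfun.rep_eq)
    next
      case (Suc m)
      show ?thesis
        using bounded_linear.has_derivative[OF bounded_linear_scl
            has_derivative_power_noncommutative[of m x "ball 0 r"], of "\<alpha> n"]
        by (simp add: Suc F_def op_scale_apply [abs_def] del: power_Suc)
    qed
    show "\<forall>\<^sub>F n in sequentially. \<forall>x\<in>ball 0 r. \<forall>h.
        norm ((\<Sum>i<n. blinfun_apply (F i x) h) - blinfun_apply (D x) h) \<le> e * norm h"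
      if "e > 0" for e
      using uniform_limitD[OF unif that]
    proof eventually_elim
      case (elim n)
      show ?case
      proof (intro ballI allI)
        fix x h :: 'a assume "x \<in> ball 0 r"
        with elim have "norm ((\<Sum>i<n. F i x) - D x) \<le> e"
          by (simp add: dist_norm less_imp_le)
        then have "norm (blinfun_apply ((\<Sum>i<n. F i x) - D x) h) \<le> e * norm h"
          by (meson mult_right_mono norm_blinfun norm_ge_zero order_trans)
        then show "norm ((\<Sum>i<n. blinfun_apply (F i x) h) - blinfun_apply (D x) h) \<le> e * norm h"
          by (simp add: blinfun.diff_left blinfun.sum_left)
      qed
    qed
    show "(\<lambda>n. scl (\<alpha> n) (0 ^ n)) sums (\<Sum>n\<in>{0}. scl (\<alpha> n) (0 ^ n))"
      by (rule sums_finite) (auto simp: power_0_left)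
    have "0 < r" using r(1) norm_ge_zero[of T] by linarith
    then show "0 \<in> ball 0 r" by simp
  qed auto
  then obtain G where G: "\<And>x. x \<in> ball 0 r \<Longrightarrow> (\<lambda>n. scl (\<alpha> n) (x ^ n)) sums G x"
    "\<And>x. x \<in> ball 0 r \<Longrightarrow> (G has_derivative blinfun_apply (D x)) (at x within ball 0 r)"
    by blast
  have T_ball: "T \<in> ball 0 r" using r(1) by simp
  have G_deriv: "(G has_derivative blinfun_apply (D T)) (at T)"
    using G(2)[OF T_ball] unfolding at_within_open[OF T_ball open_ball] .
  have G_eq: "G x = alg_power_series scl \<alpha> x" if "x \<in> ball 0 r" for x
    unfolding alg_power_series_def by (rule sums_unique[OF G(1)[OF that]])
  have "(alg_power_series scl \<alpha> has_derivative blinfun_apply (D T)) (at T)"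
    by (rule has_derivative_transform_within_open[OF G_deriv open_ball T_ball G_eq])
  moreover have "D T \<in> bounded_ops scl"
    unfolding bounded_ops_def
  proof (intro CollectI allI)
    fix c h
    let ?t = "\<lambda>h n. scl (\<alpha> (Suc n)) (blinfun_apply (power_differential T n) h)"
    have t_sums: "?t h sums blinfun_apply (D T) h" for h
      using bounded_linear.sums[OF blinfun.bounded_linear_left[of h] D_sums[of T]] r(1)
      by (simp add: op_scale_apply)
    have t_scl: "?t (scl c h) = (\<lambda>n. scl c (?t h n))"
      by (simp add: fun_eq_iff power_differential_apply scale_mult_left scale_mult_right
          scale_sum_right mult.commute)
    have "?t (scl c h) sums scl c (blinfun_apply (D T) h)"
      unfolding t_scl by (rule bounded_linear.sums[OF bounded_linear_scl t_sums])
    then show "blinfun_apply (D T) (scl c h) = scl c (blinfun_apply (D T) h)"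
      using t_sums[of "scl c h"] by (rule sums_unique2[rotated])
  qed
  ultimately show ?thesis unfolding has_frechet_differential_def D_def by blast
qed

section \<open>The three expansions\<close>

lemma norm_first_series_le:
  assumes "norm T \<le> r"
  shows "norm (op_scale scl (of_nat (1 + m) * \<alpha> (1 + m)) (op_L T ^\<^sub>L (1 + m - 1))) \<le>
    real (Suc m) * norm (\<alpha> (Suc m)) * r ^ m"
proof -
  have "norm (op_scale scl (of_nat (1 + m) * \<alpha> (1 + m)) (op_L T ^\<^sub>L (1 + m - 1))) \<le>
      norm (of_nat (1 + m) * \<alpha> (1 + m)) * r ^ m"
    using norm_op_L_power_le[OF assms, of m]
    by (intro order_trans[OF norm_op_scale] mult_left_mono) auto
  then show ?thesis by (simp only: norm_mult norm_of_nat plus_1_eq_Suc)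
qed

lemma abs_unif_conv_first_series:
  assumes r: "0 < r" "ereal r < conv_radius \<alpha>"
  shows "abs_unif_conv_from 1
    (\<lambda>n T. op_scale scl (of_nat n * \<alpha> n) (op_L T ^\<^sub>L (n - 1))) (ball 0 r)"
proof (rule abs_unif_conv_fromI)
  show "summable (\<lambda>n. real (Suc n) * norm (\<alpha> (Suc n)) * r ^ n)"
    using r by (intro summable_diffs) auto
qed (rule norm_first_series_le, simp)

lemma suminf_blinfun_compose_left:
  fixes A :: "nat \<Rightarrow> 'x::real_normed_vector \<Rightarrow>\<^sub>L 'x"
  assumes "summable A"
  shows "suminf A o\<^sub>L Q = (\<Sum>m. A m o\<^sub>L Q)"
  by (rule bounded_linear.suminf[OF bounded_bilinear.bounded_linear_left
        [OF bounded_bilinear_blinfun_compose] assms])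

text \<open>
  The common step of the first two formulas. The assumption on the diagonals says that the
  \<open>n\<close>-th one, composed with \<open>Q\<close>, is the defect between \<open>(n + 2) \<alpha> h T\<^sup>n\<^sup>+\<^sup>1\<close> and the differential of
  \<open>\<alpha> T\<^sup>n\<^sup>+\<^sup>2\<close>. The indices start at degree two because the linear term has no defect. A fixed
  factor \<open>Q\<close> is kept outside the double sum, as in the first formula, where it is \<open>op_C T\<close>.
\<close>

lemma differential_eq_first_series_minus:
  fixes f :: "nat \<Rightarrow> nat \<Rightarrow> 'a \<Rightarrow>\<^sub>L 'a" and b :: "nat \<Rightarrow> nat \<Rightarrow> real"
  assumes T: "norm T \<le> r" and r: "0 < r" "ereal r < conv_radius \<alpha>"
    and b: "summable (\<lambda>n. \<Sum>p\<le>n. b p (n - p))" "\<And>p m. norm (f p m) \<le> b p m"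
    and diagonal: "\<And>n h. blinfun_apply (\<Sum>p\<le>n. f p (n - p)) (blinfun_apply Q h) =
      scl (\<alpha> (n + 2))
        (of_nat (n + 2) * (h * T ^ Suc n) - (\<Sum>i\<le>Suc n. T ^ i * h * T ^ (Suc n - i)))"
  shows "(\<Sum>n. op_scale scl (\<alpha> (Suc n)) (power_differential T n)) =
    series_from 1 (\<lambda>n. op_scale scl (of_nat n * \<alpha> n) (op_L T ^\<^sub>L (n - 1)))
      - ((\<Sum>p. \<Sum>m. f p m) o\<^sub>L Q)"
proof -
  let ?D = "\<lambda>n. op_scale scl (\<alpha> (Suc n)) (power_differential T n)"
  let ?A = "\<lambda>n. op_scale scl (of_nat (1 + n) * \<alpha> (1 + n)) (op_L T ^\<^sub>L (1 + n - 1))"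
  have D: "?D sums suminf ?D"
    using r by (intro scaled_power_differential_sums[OF T]) auto
  have "summable (\<lambda>n. real (Suc n) * norm (\<alpha> (Suc n)) * r ^ n)"
    using r by (intro summable_diffs) auto
  then have A: "?A sums suminf ?A"
    by (rule summable_sums[OF summable_comparison_test'[OF _ norm_first_series_le[OF T, of _ \<alpha>]]])
  have shift: "?A (Suc n) - ?D (Suc n) = (\<Sum>p\<le>n. f p (n - p)) o\<^sub>L Q" for n
    by (rule blinfun_eqI)
       (simp add: blinfun.diff_left op_scale_apply diagonal scl_of_nat_mult
          power_differential_apply scale_right_diff_distrib scale_mult_right
          del: sum.atMost_Suc power_Suc of_nat_Suc of_nat_add op_power_Suc)
  have zero: "?A 0 - ?D 0 = 0"
    by (rule blinfun_eqI) (simp add: blinfun.diff_left op_scale_apply power_differential_apply)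
  have "(\<lambda>n. ?A n - ?D n) sums (suminf ?A - suminf ?D)"
    by (rule sums_diff[OF A D])
  then have "(\<lambda>n. ?A (Suc n) - ?D (Suc n)) sums (suminf ?A - suminf ?D)"
    using zero by (subst sums_Suc_iff) simp
  then have "(\<lambda>n. (\<Sum>p\<le>n. f p (n - p)) o\<^sub>L Q) sums (suminf ?A - suminf ?D)"
    unfolding shift .
  moreover have "(\<lambda>n. (\<Sum>p\<le>n. f p (n - p)) o\<^sub>L Q) sums ((\<Sum>p. \<Sum>m. f p m) o\<^sub>L Q)"
    by (rule bounded_linear.sums[OF bounded_bilinear.bounded_linear_left
          [OF bounded_bilinear_blinfun_compose] diagonal_sums[OF b]])
  ultimately have "suminf ?A - suminf ?D = (\<Sum>p. \<Sum>m. f p m) o\<^sub>L Q"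
    by (rule sums_unique2)
  then show ?thesis by (simp add: series_from_def algebra_simps)
qed

text \<open>
  The exponents \<open>m\<close> of \<open>op_L T\<close> and \<open>p\<close> of \<open>op_R T\<close> index the double family, and the coefficient of
  degree \<open>p + m + 2\<close> has weight \<open>m + 1\<close>. The weights on the \<open>n\<close>-th diagonal are at most \<open>n + 2\<close>
  and there are \<open>n + 1\<close> of them, which gives the second formal derivative as majorant.
\<close>

lemma power_products_expansion:
  fixes \<alpha> :: "nat \<Rightarrow> 'k"
  defines "tail \<equiv> \<lambda>p n T.
      op_scale scl (of_nat (n - p - 1) * \<alpha> n) (op_L T ^\<^sub>L (n - (2 + p)))"
  assumes r: "0 < r" "ereal r < conv_radius \<alpha>"
  shows power_products_tail: "abs_unif_conv_from (p + 2) (tail p) (ball 0 r)"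
    and power_products_outer: "abs_unif_conv_from 0
      (\<lambda>p T. series_from (p + 2) (\<lambda>n. tail p n T) o\<^sub>L (op_R T ^\<^sub>L p)) (ball 0 r)"
    and power_products_eq: "norm T < r \<Longrightarrow>
      (\<Sum>n. op_scale scl (\<alpha> (Suc n)) (power_differential T n)) =
      series_from 1 (\<lambda>n. op_scale scl (of_nat n * \<alpha> n) (op_L T ^\<^sub>L (n - 1)))
      - (series_from 0 (\<lambda>p. series_from (p + 2) (\<lambda>n. tail p n T) o\<^sub>L (op_R T ^\<^sub>L p))
         o\<^sub>L op_C T)"
proof -
  define d where "d p m = real (Suc m) * norm (\<alpha> (p + 2 + m)) * r ^ m" for p m
  define b where "b p m = d p m * r ^ p" for p m
  define f where "f T p m = tail p (p + 2 + m) T o\<^sub>L (op_R T ^\<^sub>L p)" for T p m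
  have tail_eq: "tail p (p + 2 + m) T =
      op_scale scl (of_nat (Suc m) * \<alpha> (p + 2 + m)) (op_L T ^\<^sub>L m)" for p m T
  proof -
    have "p + 2 + m - p - 1 = Suc m" "p + 2 + m - (2 + p) = m" by auto
    then show ?thesis by (simp only: tail_def)
  qed
  have tail_le: "norm (tail p (p + 2 + m) T) \<le> d p m" if "norm T \<le> r" for p m T
  proof -
    have "norm (tail p (p + 2 + m) T) \<le> norm (of_nat (Suc m) * \<alpha> (p + 2 + m)) * r ^ m"
      unfolding tail_eq using norm_op_L_power_le[OF that, of m]
      by (intro order_trans[OF norm_op_scale] mult_left_mono) auto
    then show ?thesis by (simp only: norm_mult norm_of_nat d_def)
  qed
  have f_le: "norm (f T p m) \<le> b p m" if "norm T \<le> r" for T p m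
    unfolding f_def b_def
    using r tail_le[OF that] norm_op_R_power_le[OF that]
    by (intro order_trans[OF norm_blinfun_compose] mult_mono) (auto simp: d_def)
  have b_summable: "summable (\<lambda>n. \<Sum>p\<le>n. b p (n - p))"
  proof (rule summable_comparison_test')
    show "summable (\<lambda>n. real (Suc n) * (real (n + 2) * norm (\<alpha> (n + 2))) * r ^ n)"
      using r by (intro summable_diffs_diffs) auto
    show "norm (\<Sum>p\<le>n. b p (n - p)) \<le> real (Suc n) * (real (n + 2) * norm (\<alpha> (n + 2))) * r ^ n"
      for n
    proof -
      have "norm (b p (n - p)) \<le> real (n + 2) * norm (\<alpha> (n + 2)) * r ^ n" if "p \<le> n" for p
      proof -
        have "b p (n - p) = real (Suc (n - p)) * norm (\<alpha> (n + 2)) * (r ^ (n - p) * r ^ p)"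
          using that by (simp add: b_def d_def)
        also have "r ^ (n - p) * r ^ p = r ^ n"
          using that by (simp add: power_add [symmetric])
        finally have "b p (n - p) = real (Suc (n - p)) * norm (\<alpha> (n + 2)) * r ^ n" .
        with r show ?thesis by (auto simp: abs_mult intro!: mult_right_mono)
      qed
      then have "norm (\<Sum>p\<le>n. b p (n - p)) \<le>
          (\<Sum>p\<le>n. real (n + 2) * norm (\<alpha> (n + 2)) * r ^ n)"
        by (intro sum_norm_le) auto
      then show ?thesis by (simp add: mult_ac)
    qed
  qed
  \<comment> \<open>\<open>d p\<close> is a row of the majorant up to a constant factor, which is nonzero since \<open>r > 0\<close>.\<close>
  have d_summable: "summable (d p)" for p
  proof -
    have "summable (\<lambda>m. b p m * inverse (r ^ p))"
      using summable_row[OF b_summable f_le[of 0]] r by (intro summable_mult2) auto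
    then show ?thesis using r by (simp add: b_def field_simps)
  qed
  show "abs_unif_conv_from (p + 2) (tail p) (ball 0 r)"
    by (rule abs_unif_conv_fromI[OF d_summable[of p]], rule tail_le, simp)
  have row: "series_from (p + 2) (\<lambda>n. tail p n T) o\<^sub>L (op_R T ^\<^sub>L p) = (\<Sum>m. f T p m)"
    if "norm T \<le> r" for p T
    unfolding series_from_def f_def
    by (rule suminf_blinfun_compose_left, rule summable_comparison_test'[OF d_summable[of p]])
       (rule tail_le[OF that])
  show "abs_unif_conv_from 0
      (\<lambda>p T. series_from (p + 2) (\<lambda>n. tail p n T) o\<^sub>L (op_R T ^\<^sub>L p)) (ball 0 r)"
  proof (rule abs_unif_conv_fromI)
    show "summable (\<lambda>p. \<Sum>m. b p m)"
      using r by (intro summable_rows[OF b_summable f_le[of 0]]) auto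
    show "norm (series_from (0 + p + 2) (\<lambda>n. tail (0 + p) n T) o\<^sub>L (op_R T ^\<^sub>L (0 + p))) \<le>
        (\<Sum>m. b p m)" if "T \<in> ball 0 r" for p T
    proof -
      have T: "norm T \<le> r" using that by simp
      show ?thesis
        unfolding add_0 row[OF T]
        by (rule norm_suminf_le[OF f_le[OF T] summable_row[OF b_summable f_le[OF T]]])
    qed
  qed
  assume "norm T < r"
  then have T: "norm T \<le> r" by simp
  have "(\<Sum>n. op_scale scl (\<alpha> (Suc n)) (power_differential T n)) =
      series_from 1 (\<lambda>n. op_scale scl (of_nat n * \<alpha> n) (op_L T ^\<^sub>L (n - 1)))
      - ((\<Sum>p. \<Sum>m. f T p m) o\<^sub>L op_C T)"
  proof (rule differential_eq_first_series_minus[OF T r b_summable f_le[OF T]])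
    fix n h
    have "blinfun_apply (\<Sum>p\<le>n. f T p (n - p)) (blinfun_apply (op_C T) h) =
        (\<Sum>p\<le>n. scl (\<alpha> (n + 2))
          (of_nat (Suc (n - p)) * (T ^ p * (h * T - T * h) * T ^ (n - p))))"
      unfolding blinfun.sum_left f_def tail_eq
      by (intro sum.cong refl)
         (simp add: op_scale_apply op_C_apply scl_of_nat_mult scale_mult_right mult.assoc
            del: of_nat_Suc)
    then show "blinfun_apply (\<Sum>p\<le>n. f T p (n - p)) (blinfun_apply (op_C T) h) =
        scl (\<alpha> (n + 2)) (of_nat (n + 2) * (h * T ^ Suc n) -
          (\<Sum>i\<le>Suc n. T ^ i * h * T ^ (Suc n - i)))"
      by (simp only: scale_sum_right [symmetric] weighted_commutator_identity)
  qed
  then show "(\<Sum>n. op_scale scl (\<alpha> (Suc n)) (power_differential T n)) =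
      series_from 1 (\<lambda>n. op_scale scl (of_nat n * \<alpha> n) (op_L T ^\<^sub>L (n - 1)))
      - (series_from 0 (\<lambda>p. series_from (p + 2) (\<lambda>n. tail p n T) o\<^sub>L (op_R T ^\<^sub>L p))
         o\<^sub>L op_C T)"
    by (simp only: series_from_def[of 0] add_0 row[OF T])
qed

text \<open>
  With \<open>k = p + 2\<close> the double family has the exponent \<open>m\<close> of \<open>op_L T\<close> and the commutator with
  \<open>T\<^sup>p\<^sup>+\<^sup>1\<close>, whose norm is at most \<open>2 r\<^sup>p\<^sup>+\<^sup>1\<close>. The diagonals carry no weights, but the number of their
  terms makes the second formal derivative a convenient majorant again.
\<close>

lemma commutator_of_powers_expansion:
  fixes \<alpha> :: "nat \<Rightarrow> 'k"
  defines "tail \<equiv> \<lambda>k n T. op_scale scl (\<alpha> n) (op_L T ^\<^sub>L (n - k))"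
  assumes r: "0 < r" "ereal r < conv_radius \<alpha>"
  shows commutator_of_powers_tail: "k \<ge> 2 \<Longrightarrow> abs_unif_conv_from k (tail k) (ball 0 r)"
    and commutator_of_powers_outer: "abs_unif_conv_from 2
      (\<lambda>k T. series_from k (\<lambda>n. tail k n T) o\<^sub>L op_C (T ^ (k - 1))) (ball 0 r)"
    and commutator_of_powers_eq: "norm T < r \<Longrightarrow>
      (\<Sum>n. op_scale scl (\<alpha> (Suc n)) (power_differential T n)) =
      series_from 1 (\<lambda>n. op_scale scl (of_nat n * \<alpha> n) (op_L T ^\<^sub>L (n - 1)))
      - series_from 2 (\<lambda>k. series_from k (\<lambda>n. tail k n T) o\<^sub>L op_C (T ^ (k - 1)))"
proof -
  define d where "d p m = norm (\<alpha> (2 + p + m)) * r ^ m" for p m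
  define b where "b p m = d p m * (2 * r ^ Suc p)" for p m
  define f where "f T p m = tail (2 + p) (2 + p + m) T o\<^sub>L op_C (T ^ Suc p)" for T p m
  have tail_eq: "tail k (k + m) T = op_scale scl (\<alpha> (k + m)) (op_L T ^\<^sub>L m)" for k m T
    by (simp add: tail_def)
  have tail_le: "norm (tail (2 + p) (2 + p + m) T) \<le> d p m" if "norm T \<le> r" for p m T
    unfolding tail_eq d_def using norm_op_L_power_le[OF that, of m]
    by (intro order_trans[OF norm_op_scale] mult_left_mono) auto
  have f_le: "norm (f T p m) \<le> b p m" if "norm T \<le> r" for T p m
  proof -
    have "norm (T ^ Suc p) \<le> r ^ Suc p"
      using norm_power_ineq[of T "Suc p"] power_mono[OF that, of "Suc p"] by (simp del: power_Suc)
    from norm_op_C_le[OF this] show ?thesis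
      unfolding f_def b_def using r tail_le[OF that]
      by (intro order_trans[OF norm_blinfun_compose] mult_mono) (auto simp: d_def)
  qed
  have b_summable: "summable (\<lambda>n. \<Sum>p\<le>n. b p (n - p))"
  proof (rule summable_comparison_test')
    show "summable (\<lambda>n. 2 * r * (real (Suc n) * (real (n + 2) * norm (\<alpha> (n + 2))) * r ^ n))"
      using r by (intro summable_mult summable_diffs_diffs) auto
    show "norm (\<Sum>p\<le>n. b p (n - p)) \<le>
        2 * r * (real (Suc n) * (real (n + 2) * norm (\<alpha> (n + 2))) * r ^ n)" for n
    proof -
      have "norm (b p (n - p)) \<le> 2 * r * (real (n + 2) * norm (\<alpha> (n + 2)) * r ^ n)"
        if "p \<le> n" for p
      proof -
        have "b p (n - p) = 2 * r * norm (\<alpha> (n + 2)) * (r ^ (n - p) * r ^ p)"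
          using that by (simp add: b_def d_def)
        also have "r ^ (n - p) * r ^ p = r ^ n"
          using that by (simp add: power_add [symmetric])
        finally have eq: "b p (n - p) = 2 * r * (1 * norm (\<alpha> (n + 2)) * r ^ n)" by simp
        also have "\<dots> \<le> 2 * r * (real (n + 2) * norm (\<alpha> (n + 2)) * r ^ n)"
          using r by (intro mult_left_mono mult_right_mono) auto
        finally show ?thesis using eq r by simp
      qed
      then have "norm (\<Sum>p\<le>n. b p (n - p)) \<le>
          (\<Sum>p\<le>n. 2 * r * (real (n + 2) * norm (\<alpha> (n + 2)) * r ^ n))"
        by (intro sum_norm_le) auto
      then show ?thesis by (simp add: mult_ac)
    qed
  qed
  \<comment> \<open>\<open>d p\<close> is a row of the majorant up to a constant factor, which is nonzero since \<open>r > 0\<close>.\<close>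
  have d_summable: "summable (d p)" for p
  proof -
    have "summable (\<lambda>m. b p m * inverse (2 * r ^ Suc p))"
      using summable_row[OF b_summable f_le[of 0]] r by (intro summable_mult2) auto
    then show ?thesis using r by (simp add: b_def field_simps)
  qed
  show "abs_unif_conv_from k (tail k) (ball 0 r)" if k: "k \<ge> 2"
  proof -
    obtain p where p: "k = 2 + p"
      using le_Suc_ex[OF k] by blast
    show ?thesis
      unfolding p by (rule abs_unif_conv_fromI[OF d_summable[of p]], rule tail_le, simp)
  qed
  have row: "series_from (2 + p) (\<lambda>n. tail (2 + p) n T) o\<^sub>L op_C (T ^ (2 + p - 1)) =
      (\<Sum>m. f T p m)" if "norm T \<le> r" for p T
  proof -
    have "2 + p - 1 = Suc p" by simp
    show ?thesis
      unfolding series_from_def f_def \<open>2 + p - 1 = Suc p\<close>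
      by (rule suminf_blinfun_compose_left, rule summable_comparison_test'[OF d_summable[of p]])
         (rule tail_le[OF that])
  qed
  show "abs_unif_conv_from 2
      (\<lambda>k T. series_from k (\<lambda>n. tail k n T) o\<^sub>L op_C (T ^ (k - 1))) (ball 0 r)"
  proof (rule abs_unif_conv_fromI)
    show "summable (\<lambda>p. \<Sum>m. b p m)"
      using r by (intro summable_rows[OF b_summable f_le[of 0]]) auto
    show "norm (series_from (2 + p) (\<lambda>n. tail (2 + p) n T) o\<^sub>L op_C (T ^ (2 + p - 1))) \<le>
        (\<Sum>m. b p m)" if "T \<in> ball 0 r" for p T
    proof -
      have T: "norm T \<le> r" using that by simp
      show ?thesis
        unfolding row[OF T]
        by (rule norm_suminf_le[OF f_le[OF T] summable_row[OF b_summable f_le[OF T]]])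
    qed
  qed
  assume "norm T < r"
  then have T: "norm T \<le> r" by simp
  have "(\<Sum>n. op_scale scl (\<alpha> (Suc n)) (power_differential T n)) =
      series_from 1 (\<lambda>n. op_scale scl (of_nat n * \<alpha> n) (op_L T ^\<^sub>L (n - 1)))
      - ((\<Sum>p. \<Sum>m. f T p m) o\<^sub>L id_blinfun)"
  proof (rule differential_eq_first_series_minus[OF T r b_summable f_le[OF T]])
    fix n h
    have "blinfun_apply (\<Sum>p\<le>n. f T p (n - p)) (blinfun_apply id_blinfun h) =
        (\<Sum>p\<le>n. scl (\<alpha> (n + 2)) ((h * T ^ Suc p - T ^ Suc p * h) * T ^ (n - p)))"
      unfolding blinfun.sum_left f_def tail_eq
      by (intro sum.cong refl) (simp add: op_scale_apply op_C_apply)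
    then show "blinfun_apply (\<Sum>p\<le>n. f T p (n - p)) (blinfun_apply id_blinfun h) =
        scl (\<alpha> (n + 2)) (of_nat (n + 2) * (h * T ^ Suc n) -
          (\<Sum>i\<le>Suc n. T ^ i * h * T ^ (Suc n - i)))"
      by (simp only: scale_sum_right [symmetric] commutator_of_powers_identity)
  qed
  moreover have "(\<Sum>p. \<Sum>m. f T p m) o\<^sub>L id_blinfun = (\<Sum>p. \<Sum>m. f T p m)"
    by (rule blinfun_eqI) simp
  ultimately show "(\<Sum>n. op_scale scl (\<alpha> (Suc n)) (power_differential T n)) =
      series_from 1 (\<lambda>n. op_scale scl (of_nat n * \<alpha> n) (op_L T ^\<^sub>L (n - 1)))
      - series_from 2 (\<lambda>k. series_from k (\<lambda>n. tail k n T) o\<^sub>L op_C (T ^ (k - 1)))"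
    by (simp only: series_from_def[of 2] row[OF T])
qed

text \<open>
  The outer series runs over \<open>p = q + 1\<close>. The factorials cancel and leave the binomial
  coefficient in \<open>u q m\<close>. The diagonals of the majorant are the divided differences estimated
  in \<open>sum_binomial_times_power_le\<close>, so the coefficient series has to converge at \<open>3 r\<close>.
\<close>

lemma taylor_commutator_expansion:
  fixes \<alpha> :: "nat \<Rightarrow> 'k"
  defines "outer \<equiv> \<lambda>p T. op_scale scl (1 / fact p)
      (op_deriv_series scl \<alpha> p (op_R T) o\<^sub>L (op_C T ^\<^sub>L (p - 1)))"
  assumes r: "0 < r" "ereal (3 * r) < conv_radius \<alpha>"
  shows taylor_commutator_outer: "abs_unif_conv_from 1 outer (ball 0 r)"
    and taylor_commutator_eq: "norm T < r \<Longrightarrow>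
      (\<Sum>n. op_scale scl (\<alpha> (Suc n)) (power_differential T n)) =
      series_from 1 (\<lambda>p. outer p T)"
proof -
  define u where "u q m = (of_nat (Suc (q + m) choose Suc q) * \<alpha> (Suc (q + m)) :: 'k)" for q m
  define b where "b q m = norm (u q m) * r ^ m * (2 * r) ^ q" for q m
  define f where "f T q m = op_scale scl (u q m) ((op_R T ^\<^sub>L m) o\<^sub>L (op_C T ^\<^sub>L q))" for T q m
  have f_le: "norm (f T q m) \<le> b q m" if "norm T \<le> r" for T q m
  proof -
    have "norm ((op_R T ^\<^sub>L m) o\<^sub>L (op_C T ^\<^sub>L q)) \<le> r ^ m * (2 * r) ^ q"
      using r norm_op_R_power_le[OF that] norm_op_power_le[OF norm_op_C_le[OF that]]
      by (intro order_trans[OF norm_blinfun_compose] mult_mono) auto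
    then show ?thesis
      unfolding f_def b_def mult.assoc
      by (intro order_trans[OF norm_op_scale] mult_left_mono) auto
  qed
  have b_summable: "summable (\<lambda>n. \<Sum>q\<le>n. b q (n - q))"
  proof (rule summable_comparison_test')
    show "summable (\<lambda>n. real (Suc n) * norm (\<alpha> (Suc n)) * (3 * r) ^ n)"
      using r by (intro summable_diffs) auto
    show "norm (\<Sum>q\<le>n. b q (n - q)) \<le> real (Suc n) * norm (\<alpha> (Suc n)) * (3 * r) ^ n" for n
    proof -
      have "(\<Sum>q\<le>n. b q (n - q)) = norm (\<alpha> (Suc n)) *
          (\<Sum>q\<le>n. real (Suc n choose Suc q) * (r ^ (n - q) * (2 * r) ^ q))"
        unfolding sum_distrib_left
        by (intro sum.cong refl)
           (simp add: b_def u_def norm_mult del: binomial_Suc_Suc power_mult_distrib)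
      also have "\<dots> \<le> norm (\<alpha> (Suc n)) * (real (Suc n) * (3 * r) ^ n)"
        using r by (intro mult_left_mono sum_binomial_times_power_le) auto
      finally have "(\<Sum>q\<le>n. b q (n - q)) \<le> real (Suc n) * norm (\<alpha> (Suc n)) * (3 * r) ^ n"
        by (simp only: mult_ac)
      moreover have "0 \<le> (\<Sum>q\<le>n. b q (n - q))"
        using r by (intro sum_nonneg) (auto simp: b_def)
      ultimately show ?thesis by simp
    qed
  qed
  have row: "outer (1 + q) T = (\<Sum>m. f T q m)" if T: "norm T \<le> r" for q T
  proof -
    let ?A = "\<lambda>m. op_scale scl
      (fact (1 + q) * of_nat (1 + q + m choose (1 + q)) * \<alpha> (1 + q + m))
      (op_R T ^\<^sub>L (1 + q + m - (1 + q)))"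
    let ?\<Phi> = "\<lambda>S. op_scale scl (1 / fact (1 + q)) (S o\<^sub>L (op_C T ^\<^sub>L (1 + q - 1)))"
    have lin: "bounded_linear ?\<Phi>"
      by (rule bounded_linear_compose[OF bounded_linear_op_scale
            bounded_bilinear.bounded_linear_left[OF bounded_bilinear_blinfun_compose]])
    \<comment> \<open>Undo the factors that the outer map \<open>?\<Phi>\<close> contributes to the majorant.\<close>
    have "norm (?A m) \<le> fact (1 + q) * inverse ((2 * r) ^ q) * b q m" for m
    proof -
      have "norm (?A m) \<le> norm (fact (1 + q) * u q m) * r ^ m"
        using norm_op_R_power_le[OF T, of m]
        by (intro order_trans[OF norm_op_scale])
           (simp add: u_def mult.assoc mult_left_mono del: fact_Suc binomial_Suc_Suc)
      also have "\<dots> = fact (1 + q) * inverse ((2 * r) ^ q) * b q m"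
        using r by (simp add: b_def norm_mult field_simps del: fact_Suc)
      finally show ?thesis .
    qed
    then have "summable ?A"
      by (intro summable_comparison_test'[OF summable_mult[OF summable_row
            [OF b_summable f_le[OF T]]]])
    then have "?\<Phi> (\<Sum>m. ?A m) = (\<Sum>m. ?\<Phi> (?A m))"
      by (rule bounded_linear.suminf[OF lin])
    moreover have "?\<Phi> (?A m) = f T q m" for m
      by (rule blinfun_eqI)
         (simp add: f_def u_def op_scale_apply del: fact_Suc binomial_Suc_Suc)
    ultimately show ?thesis
      by (simp add: outer_def op_deriv_series_def series_from_def)
  qed
  show "abs_unif_conv_from 1 outer (ball 0 r)"
  proof (rule abs_unif_conv_fromI)
    show "summable (\<lambda>q. \<Sum>m. b q m)"
      using r by (intro summable_rows[OF b_summable f_le[of 0]]) auto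
    show "norm (outer (1 + q) T) \<le> (\<Sum>m. b q m)" if "T \<in> ball 0 r" for q T
    proof -
      have T: "norm T \<le> r" using that by simp
      show ?thesis
        unfolding row[OF T]
        by (rule norm_suminf_le[OF f_le[OF T] summable_row[OF b_summable f_le[OF T]]])
    qed
  qed
  assume "norm T < r"
  then have T: "norm T \<le> r" by simp
  have "(\<Sum>q\<le>n. f T q (n - q)) = op_scale scl (\<alpha> (Suc n)) (power_differential T n)" for n
  proof (rule blinfun_eqI)
    fix h
    define c where "c q = blinfun_apply (op_C T ^\<^sub>L q) h" for q
    have step: "c (Suc q) = c q * T - T * c q" for q
      by (simp add: c_def op_C_apply)
    have "blinfun_apply (\<Sum>q\<le>n. f T q (n - q)) h =
        (\<Sum>q\<le>n. scl (\<alpha> (Suc n)) (of_nat (Suc n choose Suc q) * (T ^ (n - q) * c q)))"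
      unfolding blinfun.sum_left
      by (intro sum.cong refl)
         (simp add: f_def u_def c_def op_scale_apply scl_of_nat_mult scale_mult_right
            del: binomial_Suc_Suc)
    also have "\<dots> = scl (\<alpha> (Suc n)) (\<Sum>i\<le>n. T ^ i * c 0 * T ^ (n - i))"
      by (simp only: scale_sum_right [symmetric] binomial_commutator_identity[of c, OF step])
    finally show "blinfun_apply (\<Sum>q\<le>n. f T q (n - q)) h =
        blinfun_apply (op_scale scl (\<alpha> (Suc n)) (power_differential T n)) h"
      by (simp add: op_scale_apply power_differential_apply c_def)
  qed
  then have "(\<lambda>n. op_scale scl (\<alpha> (Suc n)) (power_differential T n)) sums (\<Sum>q. \<Sum>m. f T q m)"
    using diagonal_sums[OF b_summable f_le[OF T]] by simp
  then have "(\<Sum>n. op_scale scl (\<alpha> (Suc n)) (power_differential T n)) = (\<Sum>q. \<Sum>m. f T q m)"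
    by (rule sums_unique [symmetric])
  then show "(\<Sum>n. op_scale scl (\<alpha> (Suc n)) (power_differential T n)) =
      series_from 1 (\<lambda>p. outer p T)"
    by (simp only: series_from_def row[OF T])
qed

end

theorem theorem2p11:
  fixes scl :: "'k::{real_normed_field,banach} \<Rightarrow> 'a::{real_normed_algebra_1,banach} \<Rightarrow> 'a"
    and \<alpha> :: "nat \<Rightarrow> 'k"
    and R :: ereal
    and g :: "'a \<Rightarrow> 'a"
    and g1 :: "'a \<Rightarrow> ('a \<Rightarrow>\<^sub>L 'a)"
  assumes "unital_banach_algebra scl"
    and "conv_radius \<alpha> = R"
    and "R > 0"
    and "g = alg_power_series scl \<alpha>"
    and "g1 = frechet_differential scl g"
  shows
    "(\<forall>T \<in> eball 0 R. has_frechet_differential scl g (g1 T) T) \<and>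
     ((\<forall>T \<in> eball 0 R.
         g1 T = series_from 1 (\<lambda>n. op_scale scl (of_nat n * \<alpha> n) (op_L T ^\<^sub>L (n - 1)))
           - (series_from 0 (\<lambda>p.
                series_from (p + 2)
                  (\<lambda>n. op_scale scl (of_nat (n - p - 1) * \<alpha> n) (op_L T ^\<^sub>L (n - (2 + p))))
                o\<^sub>L (op_R T ^\<^sub>L p))
              o\<^sub>L op_C T)) \<and>
      (\<forall>r. 0 < r \<and> ereal r < R \<longrightarrow>
         abs_unif_conv_from 1
           (\<lambda>n T. op_scale scl (of_nat n * \<alpha> n) (op_L T ^\<^sub>L (n - 1))) (ball 0 r) \<and>
         (\<forall>p. abs_unif_conv_from (p + 2)
           (\<lambda>n T. op_scale scl (of_nat (n - p - 1) * \<alpha> n) (op_L T ^\<^sub>L (n - (2 + p))))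
           (ball 0 r)) \<and>
         abs_unif_conv_from 0
           (\<lambda>p T. series_from (p + 2)
                    (\<lambda>n. op_scale scl (of_nat (n - p - 1) * \<alpha> n) (op_L T ^\<^sub>L (n - (2 + p))))
                  o\<^sub>L (op_R T ^\<^sub>L p))
           (ball 0 r))) \<and>
     ((\<forall>T \<in> eball 0 R.
         g1 T = series_from 1 (\<lambda>n. op_scale scl (of_nat n * \<alpha> n) (op_L T ^\<^sub>L (n - 1)))
           - series_from 2 (\<lambda>k.
               series_from k (\<lambda>n. op_scale scl (\<alpha> n) (op_L T ^\<^sub>L (n - k)))
               o\<^sub>L op_C (T ^ (k - 1)))) \<and>
      (\<forall>r. 0 < r \<and> ereal r < R \<longrightarrow>
         abs_unif_conv_from 1
           (\<lambda>n T. op_scale scl (of_nat n * \<alpha> n) (op_L T ^\<^sub>L (n - 1))) (ball 0 r) \<and>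
         (\<forall>k\<ge>2. abs_unif_conv_from k
           (\<lambda>n T. op_scale scl (\<alpha> n) (op_L T ^\<^sub>L (n - k))) (ball 0 r)) \<and>
         abs_unif_conv_from 2
           (\<lambda>k T. series_from k (\<lambda>n. op_scale scl (\<alpha> n) (op_L T ^\<^sub>L (n - k)))
                  o\<^sub>L op_C (T ^ (k - 1)))
           (ball 0 r))) \<and>
     ((\<forall>T \<in> eball 0 (R / 3).
         g1 T = series_from 1 (\<lambda>p.
           op_scale scl (1 / fact p)
             (op_deriv_series scl \<alpha> p (op_R T) o\<^sub>L (op_C T ^\<^sub>L (p - 1))))) \<and>
      (\<forall>r. 0 < r \<and> ereal r < R / 3 \<longrightarrow>
         abs_unif_conv_from 1
           (\<lambda>p T. op_scale scl (1 / fact p)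
             (op_deriv_series scl \<alpha> p (op_R T) o\<^sub>L (op_C T ^\<^sub>L (p - 1))))
           (ball 0 r)))"
proof -
  interpret unital_banach_algebra scl by fact
  define D where "D T = (\<Sum>n. op_scale scl (\<alpha> (Suc n)) (power_differential T n))" for T
  have R: "conv_radius \<alpha> = R" by fact
  have g: "has_frechet_differential scl g (D T) T" if "T \<in> eball 0 R" for T
    using that power_series_has_frechet_differential[of T \<alpha>]
    by (simp add: D_def R assms(4) in_eball_iff)
  have g1: "g1 T = D T" if "T \<in> eball 0 R" for T
    unfolding assms(5) by (rule frechet_differential_eqI[OF g[OF that]])
  have larger_radius: "\<exists>r. 0 < r \<and> norm T < r \<and> ereal r < S" if "T \<in> eball 0 S"
    for T :: 'a and S
  proof -
    have "ereal (norm T) < S" using that by (simp add: in_eball_iff)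
    then obtain r where "norm T < r" "ereal r < S"
      using ereal_dense2[of "ereal (norm T)" S] by auto
    then show ?thesis using norm_ge_zero[of T] by (intro exI[of _ r]) linarith
  qed
  have third: "T \<in> eball 0 R" if "T \<in> eball 0 (R / 3)" for T :: 'a
  proof -
    have "ereal (3 * norm T) < R" 
      using that by (simp only: in_eball_iff ereal_less_third_iff dist_0_norm)
    then have "ereal (norm T) < R"
      by (rule order.strict_trans1[rotated]) simp
    then show ?thesis by (simp add: in_eball_iff)
  qed
  show ?thesis
  proof (intro conjI ballI allI impI; (elim conjE)?)
    fix T :: 'a assume T: "T \<in> eball 0 R"
    show "has_frechet_differential scl g (g1 T) T"
      unfolding g1[OF T] by (rule g[OF T])
    obtain r where r: "0 < r" "norm T < r" "ereal r < conv_radius \<alpha>"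
      using larger_radius[OF T] R by auto
    show "g1 T = series_from 1 (\<lambda>n. op_scale scl (of_nat n * \<alpha> n) (op_L T ^\<^sub>L (n - 1)))
           - (series_from 0 (\<lambda>p.
                series_from (p + 2)
                  (\<lambda>n. op_scale scl (of_nat (n - p - 1) * \<alpha> n) (op_L T ^\<^sub>L (n - (2 + p))))
                o\<^sub>L (op_R T ^\<^sub>L p))
              o\<^sub>L op_C T)"
      unfolding g1[OF T] D_def by (rule power_products_eq[OF r(1,3,2)])
    show "g1 T = series_from 1 (\<lambda>n. op_scale scl (of_nat n * \<alpha> n) (op_L T ^\<^sub>L (n - 1)))
           - series_from 2 (\<lambda>k.
               series_from k (\<lambda>n. op_scale scl (\<alpha> n) (op_L T ^\<^sub>L (n - k)))
               o\<^sub>L op_C (T ^ (k - 1)))"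
      unfolding g1[OF T] D_def by (rule commutator_of_powers_eq[OF r(1,3,2)])
  next
    fix T :: 'a assume T: "T \<in> eball 0 (R / 3)"
    obtain r where r: "0 < r" "norm T < r" "ereal (3 * r) < conv_radius \<alpha>"
      using larger_radius[OF T] unfolding R ereal_less_third_iff by blast
    show "g1 T = series_from 1 (\<lambda>p. op_scale scl (1 / fact p)
             (op_deriv_series scl \<alpha> p (op_R T) o\<^sub>L (op_C T ^\<^sub>L (p - 1))))"
      unfolding g1[OF third[OF T]] D_def by (rule taylor_commutator_eq[OF r(1,3,2)])
  next
    fix r assume "0 < r" "ereal r < R / 3"
    then show "abs_unif_conv_from 1 (\<lambda>p T. op_scale scl (1 / fact p)
             (op_deriv_series scl \<alpha> p (op_R T) o\<^sub>L (op_C T ^\<^sub>L (p - 1)))) (ball 0 r)"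
      by (intro taylor_commutator_outer) (simp_all only: R ereal_less_third_iff)
  next
    fix r assume "0 < r" "ereal r < R"
    then show "abs_unif_conv_from 1
        (\<lambda>n T. op_scale scl (of_nat n * \<alpha> n) (op_L T ^\<^sub>L (n - 1))) (ball 0 r)"
      by (intro abs_unif_conv_first_series) (simp_all add: R)
    then show "abs_unif_conv_from 1
        (\<lambda>n T. op_scale scl (of_nat n * \<alpha> n) (op_L T ^\<^sub>L (n - 1))) (ball 0 r)" .
  next
    fix r p assume "0 < r" "ereal r < R"
    then show "abs_unif_conv_from (p + 2)
        (\<lambda>n T. op_scale scl (of_nat (n - p - 1) * \<alpha> n) (op_L T ^\<^sub>L (n - (2 + p)))) (ball 0 r)"
      by (intro power_products_tail) (simp_all add: R)
  next
    fix r assume "0 < r" "ereal r < R"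
    then show "abs_unif_conv_from 0
        (\<lambda>p T. series_from (p + 2)
            (\<lambda>n. op_scale scl (of_nat (n - p - 1) * \<alpha> n) (op_L T ^\<^sub>L (n - (2 + p))))
          o\<^sub>L (op_R T ^\<^sub>L p)) (ball 0 r)"
      by (intro power_products_outer) (simp_all add: R)
  next
    fix r k assume "0 < r" "ereal r < R" "(2::nat) \<le> k"
    then show "abs_unif_conv_from k
        (\<lambda>n T. op_scale scl (\<alpha> n) (op_L T ^\<^sub>L (n - k))) (ball 0 r)"
      by (intro commutator_of_powers_tail) (simp_all add: R)
  next
    fix r assume "0 < r" "ereal r < R"
    then show "abs_unif_conv_from 2
        (\<lambda>k T. series_from k (\<lambda>n. op_scale scl (\<alpha> n) (op_L T ^\<^sub>L (n - k)))
          o\<^sub>L op_C (T ^ (k - 1))) (ball 0 r)"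
      by (intro commutator_of_powers_outer) (simp_all add: R)
  qed
qed

end
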